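(* Let $\{X_t\}_{t\in\mathbb Z}$ be an SFIEGARCH$(p,d,q)_s$ process. Suppose that $\gamma$ and $\theta$ are not both equal to zero. If $d<0.5$, then: (i) the stochastic process $\{X_t\}_{t\in\mathbb Z}$ is strictly stationary and ergodic; (ii) if $\mathbb E(|\ln(Z_0^2)|)<\infty$, the process $\{\ln(X_t^2)\}_{t\in\mathbb Z}$ is well defined and it is strictly stationary and ergodic. Moreover, if $\mathbb E([\ln(Z_0^2)]^2)<\infty$, then it is also weakly stationary.
   Context: An SFIEGARCH$(p,d,q)_s$ process is a process $\{X_t\}_{t\in\mathbb Z}$ defined by $X_t=\sigma_tZ_t$ and $\ln(\sigma_t^2)=\omega+\sum_{k=0}^\infty\lambda_{d,k}g(Z_{t-1-k})$ for all $t\in\mathbb Z$, where: $\{Z_t\}_{t\in\mathbb Z}$ is i.i.d. with zero mean and variance one; $g(Z_t)=\theta Z_t+\gamma[|Z_t|-\mathbb E(|Z_t|)]$ with $\theta,\gamma\in\mathbb R$; $\omega,d\in\mathbb R$; $s\ge1$ is an integer; $\alpha(z)=\sum_{i=0}^p(-\alpha_i)z^i$ and $\beta(z)=\sum_{j=0}^q(-\beta_j)z^j$ are real polynomials of orders $p,q$ with $\alpha_0=\beta_0=-1$, without common roots, and $\beta(z)\neq0$ for $|z|\le1$; and $\frac{\alpha(z)}{\beta(z)}(1-z^s)^{-d}=\sum_{k=0}^\infty\lambda_{d,k}z^k$, $|z|<1$. *)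

theory Defs
  imports "HOL-Probability.Probability" "HOL-Computational_Algebra.Polynomial"
begin

section \<open>Stochastic processes indexed by the integers\<close>

definition strictly_stationary :: "'a measure \<Rightarrow> (int \<Rightarrow> 'a \<Rightarrow> real) \<Rightarrow> bool" where
  "strictly_stationary M Y \<longleftrightarrow>
     (\<forall>t. Y t \<in> borel_measurable M) \<and>
     (\<forall>J h. finite J \<longrightarrow>
        distr M (Pi\<^sub>M J (\<lambda>_. borel)) (\<lambda>x. \<lambda>t\<in>J. Y (t + h) x) =
        distr M (Pi\<^sub>M J (\<lambda>_. borel)) (\<lambda>x. \<lambda>t\<in>J. Y t x))"

text \<open>Law of the whole trajectory, on the product sigma-algebra of the path space.\<close>

definition path_law :: "'a measure \<Rightarrow> (int \<Rightarrow> 'a \<Rightarrow> real) \<Rightarrow> (int \<Rightarrow> real) measure" where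
  "path_law M Y = distr M (Pi\<^sub>M UNIV (\<lambda>_. borel)) (\<lambda>x t. Y t x)"

definition shift_invariant :: "(int \<Rightarrow> real) set \<Rightarrow> bool" where
  "shift_invariant A \<longleftrightarrow> (\<lambda>y t. y (t + 1)) -` A = A"

text \<open>Every shift-invariant event of the process is trivial. This is the second half of
  ``strictly stationary and ergodic''; stationarity is not built in.\<close>

definition ergodic :: "'a measure \<Rightarrow> (int \<Rightarrow> 'a \<Rightarrow> real) \<Rightarrow> bool" where
  "ergodic M Y \<longleftrightarrow>
     (\<forall>t. Y t \<in> borel_measurable M) \<and>
     (\<forall>A \<in> sets (Pi\<^sub>M UNIV (\<lambda>_. borel)). shift_invariant A \<longrightarrow>
        measure (path_law M Y) A = 0 \<or> measure (path_law M Y) A = 1)"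

definition covariance :: "'a measure \<Rightarrow> ('a \<Rightarrow> real) \<Rightarrow> ('a \<Rightarrow> real) \<Rightarrow> real" where
  "covariance M U V =
     (\<integral>x. (U x - integral\<^sup>L M U) * (V x - integral\<^sup>L M V) \<partial>M)"

definition weakly_stationary :: "'a measure \<Rightarrow> (int \<Rightarrow> 'a \<Rightarrow> real) \<Rightarrow> bool" where
  "weakly_stationary M Y \<longleftrightarrow>
     (\<forall>t. Y t \<in> borel_measurable M) \<and>
     (\<forall>t. integrable M (\<lambda>x. (Y t x)\<^sup>2)) \<and>
     (\<forall>t h. integral\<^sup>L M (Y (t + h)) = integral\<^sup>L M (Y t)) \<and>
     (\<forall>t u h. covariance M (Y (t + h)) (Y (u + h)) = covariance M (Y t) (Y u))"

text \<open>The absolute value of the logarithm with the convention \<open>ln 0 = -\<infinity>\<close>, for use in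
  moment conditions: in HOL \<open>ln 0 = 0\<close>, so that \<open>integrable M (\<lambda>x. ln ((Z x)\<^sup>2))\<close> would not
  exclude that \<open>Z\<close> vanishes with positive probability.\<close>

definition abs_ln :: "real \<Rightarrow> ennreal" where
  "abs_ln u = (if u = 0 then \<infinity> else ennreal \<bar>ln u\<bar>)"

section \<open>SFIEGARCH processes\<close>

definition iid_process :: "'a measure \<Rightarrow> (int \<Rightarrow> 'a \<Rightarrow> real) \<Rightarrow> bool" where
  "iid_process M Z \<longleftrightarrow>
     prob_space.indep_vars M (\<lambda>_. borel) Z UNIV \<and>
     (\<forall>t. distr M borel (Z t) = distr M borel (Z 0))"

definition innovation_g ::
    "'a measure \<Rightarrow> real \<Rightarrow> real \<Rightarrow> (int \<Rightarrow> 'a \<Rightarrow> real) \<Rightarrow> int \<Rightarrow> 'a \<Rightarrow> real" where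
  "innovation_g M \<theta> \<gamma> Z t x =
     \<theta> * Z t x + \<gamma> * (\<bar>Z t x\<bar> - (\<integral>y. \<bar>Z t y\<bar> \<partial>M))"

text \<open>Complex coefficients, because roots are taken in the complex plane.\<close>

definition arma_poly :: "nat \<Rightarrow> (nat \<Rightarrow> real) \<Rightarrow> complex poly" where
  "arma_poly p a = (\<Sum>i\<le>p. monom (complex_of_real (- a i)) i)"

text \<open>The complex power is the principal branch; for \<open>norm z < 1\<close> the base \<open>1 - z ^ s\<close>
  lies in the right half plane. The last clause determines \<open>lam\<close> uniquely.\<close>

definition sfiegarch_coeffs ::
    "nat \<Rightarrow> real \<Rightarrow> nat \<Rightarrow> nat \<Rightarrow> (nat \<Rightarrow> real) \<Rightarrow> (nat \<Rightarrow> real) \<Rightarrow> (nat \<Rightarrow> real) \<Rightarrow> bool" where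
  "sfiegarch_coeffs p d q s \<alpha> \<beta> lam \<longleftrightarrow>
     s \<ge> 1 \<and> \<alpha> 0 = -1 \<and> \<beta> 0 = -1 \<and>
     degree (arma_poly p \<alpha>) = p \<and> degree (arma_poly q \<beta>) = q \<and>
     (\<nexists>z. poly (arma_poly p \<alpha>) z = 0 \<and> poly (arma_poly q \<beta>) z = 0) \<and>
     (\<forall>z. norm z \<le> 1 \<longrightarrow> poly (arma_poly q \<beta>) z \<noteq> 0) \<and>
     (\<forall>z. norm z < 1 \<longrightarrow>
        (\<lambda>k. complex_of_real (lam k) * z ^ k) sums
        (poly (arma_poly p \<alpha>) z / poly (arma_poly q \<beta>) z
          * (1 - z ^ s) powr (- complex_of_real d)))"

definition log_volatility_term ::
    "'a measure \<Rightarrow> real \<Rightarrow> real \<Rightarrow> (nat \<Rightarrow> real) \<Rightarrow> (int \<Rightarrow> 'a \<Rightarrow> real) \<Rightarrow>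
      int \<Rightarrow> 'a \<Rightarrow> nat \<Rightarrow> real" where
  "log_volatility_term M \<theta> \<gamma> lam Z t x k =
     lam k * innovation_g M \<theta> \<gamma> Z (t - 1 - int k) x"

text \<open>The volatility \<open>\<sigma> t\<close> is the positive square root of \<open>(\<sigma> t)\<^sup>2\<close>.
  Convergence of the series is deliberately not part of the definition: it is a consequence
  of \<open>d < 1/2\<close>. As \<open>suminf\<close> is total, results that rely on the series having its intended
  meaning have to state its almost sure convergence as a conclusion.\<close>

definition sfiegarch ::
    "'a measure \<Rightarrow> nat \<Rightarrow> real \<Rightarrow> nat \<Rightarrow> nat \<Rightarrow> (nat \<Rightarrow> real) \<Rightarrow> (nat \<Rightarrow> real) \<Rightarrow>
      (nat \<Rightarrow> real) \<Rightarrow> real \<Rightarrow> real \<Rightarrow> real \<Rightarrow>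
      (int \<Rightarrow> 'a \<Rightarrow> real) \<Rightarrow> (int \<Rightarrow> 'a \<Rightarrow> real) \<Rightarrow> (int \<Rightarrow> 'a \<Rightarrow> real) \<Rightarrow> bool" where
  "sfiegarch M p d q s \<alpha> \<beta> lam \<omega> \<theta> \<gamma> Z \<sigma> X \<longleftrightarrow>
     iid_process M Z \<and>
     (\<forall>t. integrable M (Z t) \<and> integrable M (\<lambda>x. (Z t x)\<^sup>2)) \<and>
     (\<forall>t. integral\<^sup>L M (Z t) = 0 \<and> prob_space.variance M (Z t) = 1) \<and>
     sfiegarch_coeffs p d q s \<alpha> \<beta> lam \<and>
     (\<forall>t. \<sigma> t \<in> borel_measurable M \<and> X t \<in> borel_measurable M) \<and>
     (\<forall>t. AE x in M. \<sigma> t x > 0 \<and> X t x = \<sigma> t x * Z t x \<and>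
        ln ((\<sigma> t x)\<^sup>2) = \<omega> + (\<Sum>k. log_volatility_term M \<theta> \<gamma> lam Z t x k))"

end

theory Submission
  imports Defs "HOL-Complex_Analysis.Cauchy_Integral_Formula"
begin

text \<open>
  The process is a measurable factor of an i.i.d. sequence: once the series for the
  log-volatility is known to converge, \<open>X t = F (\<lambda>k. Z (k + t))\<close> holds almost surely for one
  measurable functional \<open>F\<close> of the whole path, the same for all \<open>t\<close>, and likewise for
  \<open>ln ((X t)\<^sup>2)\<close>. Such factors inherit stationarity and ergodicity from the i.i.d. sequence
  (\<open>factor_of_iid_stationary_ergodic\<close>). The law of an i.i.d. sequence is a product measure, which
  the shift preserves; its invariant events are trivial because far shifts of cylinder events
  become independent of any given event (\<open>shift_ergodic\<close>).

  Convergence of the series is where \<open>d < 1/2\<close> enters. Its terms are independent and centred, with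
  variances proportional to \<open>(lam k)\<^sup>2\<close>, so by Kolmogorov's one-series theorem
  (\<open>kolmogorov_one_series\<close>, obtained here from a maximal inequality) it converges almost surely if
  \<open>lam\<close> is square summable. The coefficients of \<open>(1 - z) powr (- d)\<close> are of order
  \<open>k powr (d - 1)\<close>, hence square summable for \<open>d < 1/2\<close>; inserting \<open>z ^ s\<close> for \<open>z\<close> only spreads them
  out, and multiplication by the rational factor is a convolution with an absolutely summable
  sequence, as the denominator has no root in the closed unit disc
  (\<open>sfiegarch_coeffs_square_summable\<close>).

  For the logarithm, \<open>ln ((X t)\<^sup>2)\<close> is almost surely the sum of the log-volatility, which has a
  finite second moment by Fatou's lemma, and of \<open>ln ((Z t)\<^sup>2)\<close>. If the latter has a second moment
  too, so has the sum, and a strictly stationary process with second moments is weakly stationary.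
\<close>

section \<open>Square summability of the coefficients\<close>

text \<open>Up to sign, the binomial coefficient is asymptotic to \<open>n powr (d - 1) / \<Gamma>(d)\<close>, with
  \<open>1 / \<Gamma>(d) = 0\<close> when the binomial series terminates, so its square is
  \<open>O(n powr (2 * (d - 1)))\<close>. This exponent is below \<open>-1\<close> exactly when \<open>d < 1/2\<close>.\<close>

lemma summable_square_gbinomial:
  fixes d :: real
  assumes "d < 1 / 2"
  shows "summable (\<lambda>n. ((- d gchoose n) :: real)\<^sup>2)"
proof -
  define c where "c n = (- d gchoose n) / ((-1)^n / exp ((- d + 1) * ln (real n)))" for n
  have "c \<longlonglongrightarrow> inverse (Gamma d)"
    using gbinomial_asymptotic[of "- d"] by (simp add: c_def[abs_def])
  then have "Bseq c" by (rule convergent_imp_Bseq[OF convergentI])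
  then obtain K where K: "\<And>n. \<bar>c n\<bar> \<le> K" by (metis BseqE real_norm_def)
  have bound: "(- d gchoose n)\<^sup>2 \<le> K\<^sup>2 * real n powr (2 * (d - 1))" if "n > 0" for n
  proof -
    have "(- d gchoose n) = c n * (-1)^n * exp ((d - 1) * ln (real n))"
      by (simp add: c_def field_simps flip: exp_add exp_minus)
    then have "(- d gchoose n)\<^sup>2 = (c n)\<^sup>2 * ((-1)^n)\<^sup>2 * (exp ((d - 1) * ln (real n)))\<^sup>2"
      by (simp add: power_mult_distrib)
    also have "(exp ((d - 1) * ln (real n)))\<^sup>2 = real n powr (2 * (d - 1))"
      using that by (simp add: powr_def power2_eq_square flip: exp_add)
    also have "((-1)^n)\<^sup>2 = (1::real)" by (simp flip: power_mult)
    finally show ?thesis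
      using power_mono[OF K[of n], of 2] by (simp add: mult_right_mono)
  qed
  have "summable (\<lambda>n. K\<^sup>2 * real n powr (2 * (d - 1)))"
    using assms by (intro summable_mult) (simp add: summable_real_powr_iff)
  then show ?thesis
    by (rule summable_comparison_test'[where N = 1]) (use bound in auto)
qed

text \<open>Both sequences consist of the Taylor coefficients of \<open>f\<close> at \<open>0\<close>, already determined by \<open>f\<close>
  near \<open>0\<close>.\<close>

lemma power_series_coeffs_unique:
  fixes a b :: "nat \<Rightarrow> complex"
  assumes a: "\<And>z. norm z < 1 \<Longrightarrow> (\<lambda>n. a n * z ^ n) sums f z"
    and b: "\<And>z. norm z < 1 \<Longrightarrow> (\<lambda>n. b n * z ^ n) sums f z"
  shows "a = b"
proof
  have exp: "f has_fps_expansion Abs_fps c"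
    if c: "\<And>z. norm z < 1 \<Longrightarrow> (\<lambda>n. c n * z ^ n) sums f z" for c
  proof -
    have "ereal (norm (1/2 :: complex)) \<le> fps_conv_radius (Abs_fps c)"
      unfolding fps_conv_radius_def using c[of "1/2"]
      by (intro conv_radius_geI) (auto simp: sums_iff norm_divide)
    then have "fps_conv_radius (Abs_fps c) > 0"
      by (rule less_le_trans[rotated]) (simp add: norm_divide)
    moreover have "eventually (\<lambda>z::complex. z \<in> ball 0 1) (nhds 0)"
      by (intro eventually_nhds_in_open) auto
    then have "eventually (\<lambda>z. eval_fps (Abs_fps c) z = f z) (nhds 0)"
      by eventually_elim (use c in \<open>auto simp: eval_fps_def sums_iff\<close>)
    ultimately show ?thesis by (simp add: has_fps_expansion_def)
  qed
  show "a n = b n" for n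
    using fps_nth_fps_expansion[OF exp[OF a], of n] fps_nth_fps_expansion[OF exp[OF b], of n]
    by simp
qed

text \<open>The denominator has finitely many roots, all outside the closed unit disc. The quotient is
  therefore holomorphic on a disc of radius greater than one, and its Taylor series converges
  absolutely at \<open>1\<close>.\<close>

lemma rational_coeffs_summable:
  fixes P Q :: "complex poly"
  assumes Q: "\<And>z. norm z \<le> 1 \<Longrightarrow> poly Q z \<noteq> 0"
  obtains a where "summable (\<lambda>n. norm (a n))"
    "\<And>z. norm z \<le> 1 \<Longrightarrow> (\<lambda>n. a n * z ^ n) sums (poly P z / poly Q z)"
proof -
  have "Q \<noteq> 0" using Q[of 0] by auto
  then have fin: "finite {z. poly Q z = 0}" by (rule poly_roots_finite)
  obtain r where r: "r > 1" "\<And>z. poly Q z = 0 \<Longrightarrow> r \<le> norm z"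
  proof
    \<comment> \<open>The element \<open>2\<close> only serves the case without roots, where the minimum would be void.\<close>
    define r where "r = Min (insert 2 (norm ` {z. poly Q z = 0}))"
    show "r > 1" unfolding r_def using fin Q by (subst Min_gr_iff) (auto simp: not_le[symmetric])
    show "r \<le> norm z" if "poly Q z = 0" for z
      unfolding r_def using fin that by (intro Min_le) auto
  qed
  define f where "f z = poly P z / poly Q z" for z
  define a where "a n = (deriv ^^ n) f 0 / fact n" for n
  have "f holomorphic_on ball 0 r"
    unfolding f_def using r(2) by (intro holomorphic_intros) force
  then have sums: "(\<lambda>n. a n * z ^ n) sums f z" if "norm z < r" for z
    using holomorphic_power_series[of f 0 r z] that by (simp add: a_def)
  obtain u where u: "1 < u" "u < r" using r(1) dense by blast
  have "summable (\<lambda>n. a n * of_real u ^ n)"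
    using sums[of "of_real u"] u by (auto simp: sums_iff)
  then have "summable (\<lambda>n. norm (a n * 1 ^ n))"
    by (rule powser_insidea) (use u in auto)
  then show ?thesis
    using that[of a] sums r(1) unfolding f_def by force
qed

text \<open>The case \<open>\<ell>\<^sup>1 * \<ell>\<^sup>2 \<subseteq> \<ell>\<^sup>2\<close> of Young's inequality. Cauchy-Schwarz with the weights
  \<open>norm (a i)\<close> bounds the square of the convolution by a multiple of the convolution of
  \<open>norm (a i)\<close> with \<open>(norm (b i))\<^sup>2\<close>, and a Cauchy product of absolutely convergent series
  converges.\<close>

lemma convolution_square_summable:
  fixes a b :: "nat \<Rightarrow> 'a::real_normed_field"
  assumes a: "summable (\<lambda>n. norm (a n))" and b: "summable (\<lambda>n. (norm (b n))\<^sup>2)"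
  shows "summable (\<lambda>n. (norm (\<Sum>i\<le>n. a i * b (n - i)))\<^sup>2)"
proof -
  define A where "A = (\<Sum>n. norm (a n))"
  have "summable (\<lambda>n. \<Sum>i\<le>n. norm (a i) * (norm (b (n - i)))\<^sup>2)"
    using a b by (intro summable_Cauchy_product) auto
  then have "summable (\<lambda>n. A * (\<Sum>i\<le>n. norm (a i) * (norm (b (n - i)))\<^sup>2))"
    by (rule summable_mult)
  moreover have "(norm (\<Sum>i\<le>n. a i * b (n - i)))\<^sup>2 \<le> A * (\<Sum>i\<le>n. norm (a i) * (norm (b (n - i)))\<^sup>2)"
    for n
  proof -
    have "norm (\<Sum>i\<le>n. a i * b (n - i)) \<le> (\<Sum>i\<le>n. norm (a i * b (n - i)))"
      by (rule norm_sum)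
    also have "\<dots> = (\<Sum>i\<le>n. sqrt (norm (a i)) * (sqrt (norm (a i)) * norm (b (n - i))))"
      by (simp add: norm_mult flip: mult.assoc)
    finally have "(norm (\<Sum>i\<le>n. a i * b (n - i)))\<^sup>2 \<le> \<dots>\<^sup>2"
      by (rule power_mono) simp
    also have "\<dots> \<le> (\<Sum>i\<le>n. (sqrt (norm (a i)))\<^sup>2)
        * (\<Sum>i\<le>n. (sqrt (norm (a i)) * norm (b (n - i)))\<^sup>2)"
      by (rule Cauchy_Schwarz_ineq_sum)
    also have "\<dots> = (\<Sum>i\<le>n. norm (a i)) * (\<Sum>i\<le>n. norm (a i) * (norm (b (n - i)))\<^sup>2)"
      by (simp add: power_mult_distrib)
    also have "\<dots> \<le> A * (\<Sum>i\<le>n. norm (a i) * (norm (b (n - i)))\<^sup>2)"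
      unfolding A_def using a
      by (intro mult_right_mono sum_le_suminf sum_nonneg) auto
    finally show ?thesis .
  qed
  ultimately show ?thesis
    by (elim summable_comparison_test'[where N = 0]) simp
qed

text \<open>By the binomial series, \<open>(1 - z ^ s) powr (- d)\<close> has the binomial coefficients of \<open>- d\<close>,
  spread over the multiples of \<open>s\<close>. Hence \<open>lam\<close> is the convolution of a square summable
  sequence with the absolutely summable coefficients of the rational factor.\<close>

lemma sfiegarch_coeffs_square_summable:
  assumes "sfiegarch_coeffs p d q s \<alpha> \<beta> lam" and "d < 1 / 2"
  shows "summable (\<lambda>k. (lam k)\<^sup>2)"
proof -
  have s: "s \<ge> 1"
    and Q: "\<And>z. norm z \<le> 1 \<Longrightarrow> poly (arma_poly q \<beta>) z \<noteq> 0"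
    and lam: "\<And>z. norm z < 1 \<Longrightarrow> (\<lambda>k. complex_of_real (lam k) * z ^ k) sums
        (poly (arma_poly p \<alpha>) z / poly (arma_poly q \<beta>) z * (1 - z ^ s) powr (- complex_of_real d))"
    using assms(1) by (auto simp: sfiegarch_coeffs_def)
  from rational_coeffs_summable[OF Q, where P = "arma_poly p \<alpha>"]
  obtain a where a: "summable (\<lambda>n. norm (a n))"
    "\<And>z. norm z \<le> 1 \<Longrightarrow> (\<lambda>n. a n * z ^ n) sums (poly (arma_poly p \<alpha>) z / poly (arma_poly q \<beta>) z)"
    by blast
  define c :: "nat \<Rightarrow> complex" where
    "c k = (if s dvd k then of_real (- d gchoose (k div s)) * (-1) ^ (k div s) else 0)" for k
  have s_mono: "strict_mono (\<lambda>n. s * n)" using s by (simp add: strict_mono_def)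
  have off: "k \<notin> range (\<lambda>n. s * n) \<Longrightarrow> c k = 0" for k by (auto simp: c_def dvd_def)
  have c_s: "c (s * n) = of_real (- d gchoose n) * (-1) ^ n" for n using s by (simp add: c_def)
  have c_sums: "(\<lambda>k. c k * z ^ k) sums (1 - z ^ s) powr (- complex_of_real d)" if "norm z < 1" for z
  proof (subst sums_mono_reindex[OF s_mono, symmetric])
    show "c n * z ^ n = 0" if "n \<notin> range (\<lambda>n. s * n)" for n using off[OF that] by simp
    have "norm (- (z ^ s)) < 1" using that s by (simp add: norm_power power_less_one_iff)
    from gen_binomial_complex[OF this, of "- of_real d"]
    have "(\<lambda>n. (- complex_of_real d gchoose n) * (- (z ^ s)) ^ n)
        sums (1 - z ^ s) powr (- complex_of_real d)" by simp
    moreover have "(- complex_of_real d gchoose n) = of_real (- d gchoose n)" for n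
      by (simp add: gbinomial_prod_rev)
    ultimately show "(\<lambda>n. c (s * n) * z ^ (s * n)) sums (1 - z ^ s) powr (- complex_of_real d)"
      by (simp add: c_s power_mult power_minus[of "z ^ s"] mult.assoc)
  qed
  have c_l2: "summable (\<lambda>k. (norm (c k))\<^sup>2)"
  proof (subst summable_mono_reindex[OF s_mono, symmetric])
    show "(norm (c n))\<^sup>2 = 0" if "n \<notin> range (\<lambda>n. s * n)" for n using off[OF that] by simp
    show "summable (\<lambda>n. (norm (c (s * n)))\<^sup>2)"
      using summable_square_gbinomial[OF assms(2)] by (simp add: c_s norm_mult norm_power)
  qed
  define e where "e n = (\<Sum>i\<le>n. a i * c (n - i))" for n
  have e_sums: "(\<lambda>n. e n * z ^ n) sums
      (poly (arma_poly p \<alpha>) z / poly (arma_poly q \<beta>) z * (1 - z ^ s) powr (- complex_of_real d))"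
    if z: "norm z < 1" for z
  proof -
    \<comment> \<open>Convergence at a larger radius \<open>u\<close> makes both series absolutely convergent at \<open>z\<close>.\<close>
    obtain u where u: "norm z < u" "u < 1" using dense[OF z] by blast
    have u0: "0 < u" using u(1) norm_ge_zero[of z] by linarith
    have abs: "summable (\<lambda>n. norm (g n * z ^ n))"
      if "(\<lambda>n. g n * complex_of_real u ^ n) sums l" for g l
      by (rule powser_insidea[of _ "complex_of_real u"]) (use that u u0 in \<open>auto simp: sums_iff\<close>)
    have "(\<lambda>n. \<Sum>i\<le>n. (a i * z ^ i) * (c (n - i) * z ^ (n - i))) sums
        ((\<Sum>n. a n * z ^ n) * (\<Sum>n. c n * z ^ n))"
      using u u0 by (intro Cauchy_product_sums abs[OF a(2)] abs[OF c_sums]) auto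
    also have "(\<lambda>n. \<Sum>i\<le>n. (a i * z ^ i) * (c (n - i) * z ^ (n - i))) = (\<lambda>n. e n * z ^ n)"
      unfolding e_def sum_distrib_right
    proof (intro ext sum.cong refl)
      fix n i :: nat assume "i \<in> {..n}"
      then have "z ^ n = z ^ i * z ^ (n - i)" by (simp flip: power_add)
      then show "(a i * z ^ i) * (c (n - i) * z ^ (n - i)) = a i * c (n - i) * z ^ n"
        by (simp add: mult_ac)
    qed
    finally show ?thesis
      using a(2)[of z] c_sums[OF z] z by (simp add: sums_iff)
  qed
  have "(\<lambda>k. complex_of_real (lam k)) = e"
    by (rule power_series_coeffs_unique[OF lam e_sums])
  then have "complex_of_real (lam k) = e k" for k by metis
  then have "norm (e k) = \<bar>lam k\<bar>" for k by (metis norm_of_real)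
  then show ?thesis
    using convolution_square_summable[OF a(1) c_l2] by (simp add: e_def)
qed

section \<open>Almost sure convergence of series of independent variables\<close>

text \<open>The partial sums of \<open>y\<close>, frozen from the first time their modulus reaches \<open>a\<close>. Because a
  frozen value is at least \<open>a\<close> in modulus, the recursion can read off from the value itself
  whether the sum has been stopped, and no stopping time has to be carried along.\<close>

primrec stopped_sum :: "real \<Rightarrow> (nat \<Rightarrow> real) \<Rightarrow> nat \<Rightarrow> real" where
  "stopped_sum a y 0 = 0"
| "stopped_sum a y (Suc n) = stopped_sum a y n + (if \<bar>stopped_sum a y n\<bar> < a then y n else 0)"

lemma stopped_sum_cong: "(\<And>i. i < n \<Longrightarrow> y i = y' i) \<Longrightarrow> stopped_sum a y n = stopped_sum a y' n"
  by (induction n) auto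

lemma stopped_sum_eq_sum:
  assumes "\<And>k. k < n \<Longrightarrow> \<bar>\<Sum>i<k. y i\<bar> < a"
  shows "stopped_sum a y n = (\<Sum>i<n. y i)"
  using assms by (induction n) auto

lemma stopped_sum_ge_mono:
  "k \<le> n \<Longrightarrow> a \<le> \<bar>stopped_sum a y k\<bar> \<Longrightarrow> a \<le> \<bar>stopped_sum a y n\<bar>"
  by (induction n rule: dec_induct) auto

text \<open>Up to the first passage the stopped sum is the partial sum, and afterwards it stays put. So it
  remembers at time \<open>n\<close> any earlier passage of the partial sums.\<close>

lemma stopped_sum_exceeds:
  assumes "k \<le> n" "a \<le> \<bar>\<Sum>i<k. y i\<bar>"
  shows "a \<le> \<bar>stopped_sum a y n\<bar>"
proof -
  define j where "j = (LEAST j. a \<le> \<bar>\<Sum>i<j. y i\<bar>)"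
  have j: "a \<le> \<bar>\<Sum>i<j. y i\<bar>" "j \<le> k"
    unfolding j_def using assms(2) by (auto intro: LeastI Least_le)
  have "\<bar>\<Sum>i<m. y i\<bar> < a" if "m < j" for m
    using not_less_Least[of m] that unfolding j_def by force
  then have "stopped_sum a y j = (\<Sum>i<j. y i)" by (rule stopped_sum_eq_sum)
  then show ?thesis using stopped_sum_ge_mono[of j n a y] j assms(1) by simp
qed

lemma measurable_stopped_sum:
  assumes [measurable]: "\<And>i. i < n \<Longrightarrow> Y i \<in> borel_measurable N"
  shows "(\<lambda>x. stopped_sum a (\<lambda>i. Y i x) n) \<in> borel_measurable N"
  using assms
proof (induction n)
  case (Suc n)
  have [measurable]: "(\<lambda>x. stopped_sum a (\<lambda>i. Y i x) n) \<in> borel_measurable N"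
    "Y n \<in> borel_measurable N" using Suc by auto
  show ?case by simp
qed simp

context prob_space
begin

lemma integrable_mult_square_integrable:
  fixes f g :: "'a \<Rightarrow> real"
  assumes [measurable]: "f \<in> borel_measurable M" "g \<in> borel_measurable M"
    and sq: "integrable M (\<lambda>x. (f x)\<^sup>2)" "integrable M (\<lambda>x. (g x)\<^sup>2)"
  shows "integrable M (\<lambda>x. f x * g x)"
proof (rule Bochner_Integration.integrable_bound)
  show "integrable M (\<lambda>x. (f x)\<^sup>2 + (g x)\<^sup>2)" using sq by simp
  have "\<bar>f x * g x\<bar> \<le> (f x)\<^sup>2 + (g x)\<^sup>2" for x
    using sum_squares_bound[of "\<bar>f x\<bar>" "\<bar>g x\<bar>"] abs_ge_zero[of "f x * g x"]
    unfolding abs_mult power2_abs by linarith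
  then show "AE x in M. norm (f x * g x) \<le> norm ((f x)\<^sup>2 + (g x)\<^sup>2)" by auto
qed simp

lemma integrable_square_add:
  fixes f g :: "'a \<Rightarrow> real"
  assumes "f \<in> borel_measurable M" "g \<in> borel_measurable M"
    and "integrable M (\<lambda>x. (f x)\<^sup>2)" "integrable M (\<lambda>x. (g x)\<^sup>2)"
  shows "integrable M (\<lambda>x. (f x + g x)\<^sup>2)"
  using assms integrable_mult_square_integrable[OF assms]
  by (simp add: power2_sum mult.assoc)

lemma indep_vars_reindex:
  assumes "indep_vars (\<lambda>_. N) Y UNIV" and "inj f"
  shows "indep_vars (\<lambda>_. N) (\<lambda>i. Y (f i)) UNIV"
proof -
  have "indep_vars (\<lambda>i. Pi\<^sub>M {f i} (\<lambda>_. N)) (\<lambda>i x. \<lambda>j\<in>{f i}. Y j x) UNIV"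
    using assms by (intro indep_vars_restrict) (auto simp: disjoint_family_on_def inj_def)
  then have "indep_vars (\<lambda>_. N) (\<lambda>i x. (\<lambda>v. v (f i)) (\<lambda>j\<in>{f i}. Y j x)) UNIV"
    by (rule indep_vars_compose2) simp
  then show ?thesis by simp
qed

text \<open>The form in which independence is used below: \<open>\<phi>\<close> receives the past only, so a summand that is
  centred is orthogonal to every square integrable functional of its past.\<close>

lemma indep_past_present:
  assumes "indep_vars (\<lambda>_. borel) Y (UNIV :: nat set)"
    and [measurable]: "\<phi> \<in> borel_measurable (Pi\<^sub>M {..<n} (\<lambda>_. borel))"
  shows "indep_var borel (\<lambda>x. \<phi> (\<lambda>i\<in>{..<n}. Y i x)) borel (Y n :: 'a \<Rightarrow> real)"
proof -
  have "indep_var borel (\<phi> \<circ> (\<lambda>x. \<lambda>i\<in>{..<n}. Y i x))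
      borel ((\<lambda>v. v n) \<circ> (\<lambda>x. \<lambda>i\<in>{n}. Y i x))"
    by (rule indep_var_compose[OF indep_var_restrict[OF assms(1)]]) auto
  then show ?thesis by (simp add: comp_def)
qed

text \<open>Whether the step \<open>n\<close> is made, and from where, depends on \<open>Y 0, \<dots>, Y (n - 1)\<close> only. Each step is
  thus orthogonal to the position it starts from, and its second moment is at most that of
  \<open>Y n\<close>; the bound follows by adding up.\<close>

lemma stopped_sum_second_moment:
  fixes Y :: "nat \<Rightarrow> 'a \<Rightarrow> real"
  assumes indep: "indep_vars (\<lambda>_. borel) Y UNIV"
    and sq: "\<And>i. integrable M (\<lambda>x. (Y i x)\<^sup>2)"
    and mean: "\<And>i. expectation (Y i) = 0"
  shows "integrable M (\<lambda>x. (stopped_sum a (\<lambda>i. Y i x) n)\<^sup>2) \<and>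
    expectation (\<lambda>x. (stopped_sum a (\<lambda>i. Y i x) n)\<^sup>2) \<le> (\<Sum>i<n. expectation (\<lambda>x. (Y i x)\<^sup>2))"
proof (induction n)
  case (Suc n)
  have Y[measurable]: "Y i \<in> borel_measurable M" for i
    using indep by (auto simp: indep_vars_def2)
  define U where "U x = stopped_sum a (\<lambda>i. Y i x) n" for x
  define V where "V x = (if \<bar>U x\<bar> < a then U x else 0)" for x
  define D where "D x = (if \<bar>U x\<bar> < a then Y n x else 0)" for x
  have [measurable]: "U \<in> borel_measurable M" unfolding U_def by (rule measurable_stopped_sum) simp
  then have [measurable]: "V \<in> borel_measurable M" "D \<in> borel_measurable M"
    unfolding V_def D_def by simp_all
  have U_sq: "integrable M (\<lambda>x. (U x)\<^sup>2)" using Suc by (simp add: U_def)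
  have V_sq: "integrable M (\<lambda>x. (V x)\<^sup>2)"
    by (rule Bochner_Integration.integrable_bound[OF U_sq]) (auto simp: V_def)
  have D_sq: "integrable M (\<lambda>x. (D x)\<^sup>2)"
    by (rule Bochner_Integration.integrable_bound[OF sq[of n]]) (auto simp: D_def)
  have D_le: "expectation (\<lambda>x. (D x)\<^sup>2) \<le> expectation (\<lambda>x. (Y n x)\<^sup>2)"
    by (intro integral_mono D_sq sq) (auto simp: D_def)
  \<comment> \<open>\<open>V\<close> as a function of the past, hence independent of \<open>Y n\<close>.\<close>
  define \<phi> where "\<phi> y = (if \<bar>stopped_sum a y n\<bar> < a then stopped_sum a y n else 0)" for y
  have [measurable]: "\<phi> \<in> borel_measurable (Pi\<^sub>M {..<n} (\<lambda>_. borel))"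
  proof -
    have [measurable]: "(\<lambda>y. stopped_sum a (\<lambda>i. y i) n) \<in> borel_measurable (Pi\<^sub>M {..<n} (\<lambda>_. borel))"
      by (rule measurable_stopped_sum) simp
    show ?thesis unfolding \<phi>_def by simp
  qed
  have "stopped_sum a (\<lambda>i\<in>{..<n}. Y i x) n = U x" for x
    unfolding U_def by (rule stopped_sum_cong) simp
  then have "V = (\<lambda>x. \<phi> (\<lambda>i\<in>{..<n}. Y i x))" by (simp add: fun_eq_iff V_def \<phi>_def)
  then have "indep_var borel V borel (Y n)" using indep_past_present[OF indep, of \<phi> n] by simp
  moreover have "integrable M V" "integrable M (Y n)"
    using V_sq sq by (auto intro: square_integrable_imp_integrable)
  ultimately have VY: "expectation (\<lambda>x. V x * Y n x) = 0"
    using indep_var_lebesgue_integral[of V "Y n"] mean by simp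
  have VY_int: "integrable M (\<lambda>x. V x * Y n x)"
    by (intro integrable_mult_square_integrable V_sq sq) simp_all
  have eq: "(stopped_sum a (\<lambda>i. Y i x) (Suc n))\<^sup>2 = (U x)\<^sup>2 + 2 * (V x * Y n x) + (D x)\<^sup>2" for x
    by (simp add: U_def V_def D_def power2_sum)
  have "integrable M (\<lambda>x. (stopped_sum a (\<lambda>i. Y i x) (Suc n))\<^sup>2)"
    unfolding eq using U_sq VY_int D_sq by simp
  moreover have "expectation (\<lambda>x. (stopped_sum a (\<lambda>i. Y i x) (Suc n))\<^sup>2)
      = expectation (\<lambda>x. (U x)\<^sup>2) + expectation (\<lambda>x. (D x)\<^sup>2)"
    unfolding eq using U_sq VY_int D_sq VY by simp
  ultimately show ?case using Suc D_le by (simp add: U_def)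
qed simp

text \<open>Markov's inequality for the square of the stopped sum, which is at least \<open>a\<^sup>2\<close> as soon as
  some partial sum has reached \<open>a\<close>.\<close>

lemma kolmogorov_maximal_inequality:
  fixes Y :: "nat \<Rightarrow> 'a \<Rightarrow> real"
  assumes indep: "indep_vars (\<lambda>_. borel) Y UNIV"
    and sq: "\<And>i. integrable M (\<lambda>x. (Y i x)\<^sup>2)"
    and mean: "\<And>i. expectation (Y i) = 0"
    and "a > 0"
  shows "prob {x \<in> space M. \<exists>k\<le>n. a \<le> \<bar>\<Sum>i<k. Y i x\<bar>} \<le> (\<Sum>i<n. expectation (\<lambda>x. (Y i x)\<^sup>2)) / a\<^sup>2"
proof -
  have [measurable]: "Y i \<in> borel_measurable M" for i
    using indep by (auto simp: indep_vars_def2)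
  note U = stopped_sum_second_moment[OF indep sq mean, of a n]
  have [measurable]: "(\<lambda>x. stopped_sum a (\<lambda>i. Y i x) n) \<in> borel_measurable M"
    by (rule measurable_stopped_sum) simp
  have "a\<^sup>2 \<le> (stopped_sum a (\<lambda>i. Y i x) n)\<^sup>2" if "k \<le> n" "a \<le> \<bar>\<Sum>i<k. Y i x\<bar>" for k x
    using stopped_sum_exceeds[OF that] \<open>a > 0\<close> by (simp add: abs_le_square_iff[symmetric])
  then have "prob {x \<in> space M. \<exists>k\<le>n. a \<le> \<bar>\<Sum>i<k. Y i x\<bar>}
      \<le> prob {x \<in> space M. a\<^sup>2 \<le> (stopped_sum a (\<lambda>i. Y i x) n)\<^sup>2}"
    by (intro finite_measure_mono) auto
  also have "\<dots> \<le> expectation (\<lambda>x. (stopped_sum a (\<lambda>i. Y i x) n)\<^sup>2) / a\<^sup>2"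
    using U \<open>a > 0\<close> by (intro integral_Markov_inequality_measure[where A = "{}"]) auto
  also have "\<dots> \<le> (\<Sum>i<n. expectation (\<lambda>x. (Y i x)\<^sup>2)) / a\<^sup>2"
    using U by (intro divide_right_mono) auto
  finally show ?thesis .
qed

lemma kolmogorov_maximal_inequality_sup:
  fixes Y :: "nat \<Rightarrow> 'a \<Rightarrow> real"
  assumes indep: "indep_vars (\<lambda>_. borel) Y UNIV"
    and sq: "\<And>i. integrable M (\<lambda>x. (Y i x)\<^sup>2)"
    and mean: "\<And>i. expectation (Y i) = 0"
    and summ: "summable (\<lambda>i. expectation (\<lambda>x. (Y i x)\<^sup>2))"
    and "a > 0"
  shows "prob {x \<in> space M. \<exists>k. a \<le> \<bar>\<Sum>i<k. Y i x\<bar>} \<le> (\<Sum>i. expectation (\<lambda>x. (Y i x)\<^sup>2)) / a\<^sup>2"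
proof -
  have [measurable]: "Y i \<in> borel_measurable M" for i
    using indep by (auto simp: indep_vars_def2)
  define A where "A n = {x \<in> space M. \<exists>k\<le>n. a \<le> \<bar>\<Sum>i<k. Y i x\<bar>}" for n
  have "(\<lambda>n. prob (A n)) \<longlonglongrightarrow> prob (\<Union>n. A n)"
    by (rule finite_Lim_measure_incseq) (auto simp: A_def incseq_def intro: order_trans)
  moreover have "prob (A n) \<le> (\<Sum>i. expectation (\<lambda>x. (Y i x)\<^sup>2)) / a\<^sup>2" for n
  proof -
    have "prob (A n) \<le> (\<Sum>i<n. expectation (\<lambda>x. (Y i x)\<^sup>2)) / a\<^sup>2"
      unfolding A_def by (rule kolmogorov_maximal_inequality) fact+
    also have "\<dots> \<le> (\<Sum>i. expectation (\<lambda>x. (Y i x)\<^sup>2)) / a\<^sup>2"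
      using summ by (intro divide_right_mono sum_le_suminf) auto
    finally show ?thesis .
  qed
  ultimately have "prob (\<Union>n. A n) \<le> (\<Sum>i. expectation (\<lambda>x. (Y i x)\<^sup>2)) / a\<^sup>2"
    by (intro LIMSEQ_le_const2) auto
  also have "(\<Union>n. A n) = {x \<in> space M. \<exists>k. a \<le> \<bar>\<Sum>i<k. Y i x\<bar>}"
    by (auto simp: A_def)
  finally show ?thesis .
qed

text \<open>The maximal inequality, applied to the tail sums after \<open>m\<close>, shows that the probability that
  they ever reach a given \<open>a > 0\<close> tends to \<open>0\<close> as \<open>m\<close> grows. So, almost surely, the
  partial sums form a Cauchy sequence.\<close>

theorem kolmogorov_one_series:
  fixes Y :: "nat \<Rightarrow> 'a \<Rightarrow> real"
  assumes indep: "indep_vars (\<lambda>_. borel) Y UNIV"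
    and sq: "\<And>i. integrable M (\<lambda>x. (Y i x)\<^sup>2)"
    and mean: "\<And>i. expectation (Y i) = 0"
    and summ: "summable (\<lambda>i. expectation (\<lambda>x. (Y i x)\<^sup>2))"
  shows "AE x in M. summable (\<lambda>i. Y i x)"
proof -
  have [measurable]: "Y i \<in> borel_measurable M" for i
    using indep by (auto simp: indep_vars_def2)
  define B where "B a m = {x \<in> space M. \<exists>k. a \<le> \<bar>\<Sum>i<k. Y (i + m) x\<bar>}" for a m
  have [measurable]: "B a m \<in> sets M" for a m unfolding B_def by measurable
  have small: "prob (B a m) \<le> (\<Sum>i. expectation (\<lambda>x. (Y (i + m) x)\<^sup>2)) / a\<^sup>2" if "a > 0" for a m
    unfolding B_def
  proof (rule kolmogorov_maximal_inequality_sup)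
    show "indep_vars (\<lambda>_. borel) (\<lambda>i. Y (i + m)) UNIV"
      by (rule indep_vars_reindex[OF indep]) (simp add: inj_def)
    show "summable (\<lambda>i. expectation (\<lambda>x. (Y (i + m) x)\<^sup>2))"
      using summ summable_iff_shift[of "\<lambda>i. expectation (\<lambda>x. (Y i x)\<^sup>2)" m] by simp
  qed (use sq mean that in auto)
  have AE_B: "AE x in M. \<exists>m. x \<notin> B a m" if "a > 0" for a
  proof -
    have "(\<lambda>m. (\<Sum>i. expectation (\<lambda>x. (Y (i + m) x)\<^sup>2)) / a\<^sup>2) \<longlonglongrightarrow> 0 / a\<^sup>2"
      using summ that by (intro tendsto_divide tendsto_const suminf_exist_split2) auto
    moreover have "prob (\<Inter>m. B a m) \<le> (\<Sum>i. expectation (\<lambda>x. (Y (i + m) x)\<^sup>2)) / a\<^sup>2" for m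
    proof -
      have "prob (\<Inter>m. B a m) \<le> prob (B a m)" by (intro finite_measure_mono) auto
      then show ?thesis using small[OF that, of m] by linarith
    qed
    ultimately have "prob (\<Inter>m. B a m) \<le> 0 / a\<^sup>2" by (intro LIMSEQ_le_const) auto
    then have "prob (\<Inter>m. B a m) = 0" by (simp add: measure_le_0_iff)
    then have "(\<Inter>m. B a m) \<in> null_sets M"
      by (intro null_setsI) (auto simp: emeasure_eq_measure)
    then show ?thesis by (rule AE_I') auto
  qed
  have "AE x in M. \<forall>j. \<exists>m. x \<notin> B (1 / real (Suc j)) m"
    unfolding AE_all_countable by (intro allI AE_B) simp
  then show ?thesis
  proof (rule AE_mp, intro AE_I2 impI)
    fix x assume x: "x \<in> space M" and "\<forall>j. \<exists>m. x \<notin> B (1 / real (Suc j)) m"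
    then have tail: "\<exists>m. \<forall>k. \<bar>\<Sum>i<k. Y (i + m) x\<bar> < 1 / real (Suc j)" for j
      by (force simp: B_def not_le)
    show "summable (\<lambda>i. Y i x)"
      unfolding summable_iff_convergent Cauchy_convergent_iff[symmetric]
    proof (rule metric_CauchyI)
      fix e :: real assume "e > 0"
      then obtain j where j: "1 / real (Suc j) < e / 2"
        using nat_approx_posE[of "e / 2"] by auto
      obtain m where m: "\<And>k. \<bar>\<Sum>i<k. Y (i + m) x\<bar> < 1 / real (Suc j)" using tail by blast
      have close: "\<bar>(\<Sum>i<n. Y i x) - (\<Sum>i<m. Y i x)\<bar> < e / 2" if "n \<ge> m" for n
      proof -
        have "(\<Sum>i<m + k. Y i x) = (\<Sum>i<m. Y i x) + (\<Sum>i<k. Y (i + m) x)" for k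
          by (induction k) (simp_all add: add_ac)
        from this[of "n - m"] have "(\<Sum>i<n. Y i x) - (\<Sum>i<m. Y i x) = (\<Sum>i<n - m. Y (i + m) x)"
          using that by simp
        then show ?thesis using m[of "n - m"] j by simp
      qed
      show "\<exists>N. \<forall>m\<ge>N. \<forall>n\<ge>N. dist (\<Sum>i<m. Y i x) (\<Sum>i<n. Y i x) < e"
      proof (intro exI[of _ m] allI impI)
        fix k n assume "m \<le> k" "m \<le> n"
        then show "dist (\<Sum>i<k. Y i x) (\<Sum>i<n. Y i x) < e"
          using close[of k] close[of n] unfolding dist_real_def by linarith
      qed
    qed
  qed
qed

text \<open>The second moments of the partial sums add up by orthogonality and stay bounded, and Fatou's
  lemma passes the bound on to the almost sure limit.\<close>

lemma square_integrable_random_series: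
  fixes Y :: "nat \<Rightarrow> 'a \<Rightarrow> real"
  assumes indep: "indep_vars (\<lambda>_. borel) Y UNIV"
    and sq: "\<And>i. integrable M (\<lambda>x. (Y i x)\<^sup>2)"
    and mean: "\<And>i. expectation (Y i) = 0"
    and summ: "summable (\<lambda>i. expectation (\<lambda>x. (Y i x)\<^sup>2))"
  shows "integrable M (\<lambda>x. (\<Sum>i. Y i x)\<^sup>2)"
proof -
  have [measurable]: "Y i \<in> borel_measurable M" for i
    using indep by (auto simp: indep_vars_def2)
  define C where "C = (\<Sum>i. expectation (\<lambda>x. (Y i x)\<^sup>2))"
  have partial: "(\<integral>\<^sup>+x. ennreal ((\<Sum>i<n. Y i x)\<^sup>2) \<partial>M) \<le> ennreal C" for n
  proof -
    have eq: "expectation (\<lambda>x. (\<Sum>i<n. Y i x)\<^sup>2) = (\<Sum>i<n. expectation (\<lambda>x. (Y i x)\<^sup>2)) \<and>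
        integrable M (\<lambda>x. (\<Sum>i<n. Y i x)\<^sup>2)"
    proof (induction n)
      case (Suc n)
      define S where "S x = (\<Sum>i<n. Y i x)" for x
      have [measurable]: "S \<in> borel_measurable M" unfolding S_def by simp
      have "indep_var borel (\<lambda>x. \<Sum>i<n. (\<lambda>i\<in>{..<n}. Y i x) i) borel (Y n)"
        by (rule indep_past_present[OF indep]) simp
      then have "indep_var borel S borel (Y n)" by (simp add: S_def[abs_def])
      moreover have S_sq: "integrable M (\<lambda>x. (S x)\<^sup>2)" using Suc by (simp add: S_def)
      moreover have "integrable M S" "integrable M (Y n)"
        using S_sq sq by (auto intro: square_integrable_imp_integrable)
      ultimately have SY: "expectation (\<lambda>x. S x * Y n x) = 0"
        using indep_var_lebesgue_integral[of S "Y n"] mean by simp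
      have SY_int: "integrable M (\<lambda>x. S x * Y n x)"
        by (intro integrable_mult_square_integrable S_sq sq) simp_all
      have "(\<Sum>i<Suc n. Y i x)\<^sup>2 = (S x)\<^sup>2 + 2 * (S x * Y n x) + (Y n x)\<^sup>2" for x
        by (simp add: S_def power2_sum)
      then show ?case using Suc S_sq SY_int SY sq by (simp add: S_def)
    qed simp
    have "(\<Sum>i<n. expectation (\<lambda>x. (Y i x)\<^sup>2)) \<le> C"
      unfolding C_def using summ by (intro sum_le_suminf) auto
    then show ?thesis using eq by (simp add: nn_integral_eq_integral ennreal_leI)
  qed
  have "AE x in M. (\<lambda>n. ennreal ((\<Sum>i<n. Y i x)\<^sup>2)) \<longlonglongrightarrow> ennreal ((\<Sum>i. Y i x)\<^sup>2)"
    using kolmogorov_one_series[OF assms]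
    by eventually_elim (intro tendsto_ennrealI tendsto_power summable_LIMSEQ)
  then have "AE x in M. ennreal ((\<Sum>i. Y i x)\<^sup>2) = liminf (\<lambda>n. ennreal ((\<Sum>i<n. Y i x)\<^sup>2))"
    by eventually_elim (rule lim_imp_Liminf[OF sequentially_bot, symmetric])
  then have "(\<integral>\<^sup>+x. ennreal ((\<Sum>i. Y i x)\<^sup>2) \<partial>M)
      = (\<integral>\<^sup>+x. liminf (\<lambda>n. ennreal ((\<Sum>i<n. Y i x)\<^sup>2)) \<partial>M)"
    by (rule nn_integral_cong_AE)
  also have "\<dots> \<le> liminf (\<lambda>n. \<integral>\<^sup>+x. ennreal ((\<Sum>i<n. Y i x)\<^sup>2) \<partial>M)"
    by (rule nn_integral_liminf) simp
  also have "\<dots> \<le> ennreal C"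
    using partial by (intro Liminf_le) (auto simp: always_eventually)
  finally have "(\<integral>\<^sup>+x. ennreal ((\<Sum>i. Y i x)\<^sup>2) \<partial>M) < \<infinity>"
    by (rule le_less_trans) simp
  then show ?thesis by (intro integrableI_nonneg) auto
qed

end

section \<open>Ergodicity of i.i.d. sequences and their factors\<close>

abbreviation paths :: "(int \<Rightarrow> real) measure" where
  "paths \<equiv> Pi\<^sub>M UNIV (\<lambda>_. borel)"

definition shift :: "int \<Rightarrow> (int \<Rightarrow> real) \<Rightarrow> int \<Rightarrow> real" where
  "shift n y = (\<lambda>t. y (t + n))"

lemma shift_shift: "shift m (shift n y) = shift (m + n) y"
  by (simp add: shift_def add_ac)

lemma shift_0 [simp]: "shift 0 y = y"
  by (simp add: shift_def)

lemma measurable_pathI: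
  assumes "\<And>t. (\<lambda>x. f x t) \<in> borel_measurable N"
  shows "f \<in> measurable N paths"
  using measurable_PiM_single'[where I = UNIV and f = "\<lambda>t x. f x t" and N = N and M = "\<lambda>_. borel"] assms
  by simp

lemma measurable_shift [measurable]: "shift n \<in> measurable paths paths"
  by (rule measurable_pathI) (simp add: shift_def)

text \<open>If the events \<open>C n\<close> become independent of every event of an intersection stable generator,
  then they become independent of every event. The events \<open>A\<close> with this property form a Dynkin
  system; for a countable disjoint union, limit and sum may be exchanged by Tannery's theorem,
  as \<open>prob (A i \<inter> C n) \<le> prob (A i)\<close> uniformly in \<open>n\<close>.\<close>

lemma (in prob_space) asymptotic_independence_extend:
  assumes G: "Int_stable G" "G \<subseteq> events" "sigma_sets (space M) G = events"
    and C: "\<And>n. C n \<in> events"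
    and lim: "\<And>A. A \<in> G \<Longrightarrow> (\<lambda>n. prob (A \<inter> C n)) \<longlonglongrightarrow> prob A * c"
    and total: "(\<lambda>n. prob (C n)) \<longlonglongrightarrow> c"
    and A: "A \<in> events"
  shows "(\<lambda>n::nat. prob (A \<inter> C n)) \<longlonglongrightarrow> prob A * c"
proof -
  have "G \<subseteq> Pow (space M)" using G(2) sets.space_closed by auto
  moreover have "A \<in> sigma_sets (space M) G" using A G(3) by simp
  ultimately show ?thesis
  proof (induction rule: sigma_sets_induct_disjoint[OF G(1), consumes 2, case_names basic empty compl union])
    case (basic A)
    show ?case by (rule lim) fact
  next
    case (compl A)
    then have A: "A \<in> events" by (simp add: G(3))
    have eq: "prob ((space M - A) \<inter> C n) = prob (C n) - prob (A \<inter> C n)" for n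
    proof -
      have "(space M - A) \<inter> C n = C n - A \<inter> C n" using sets.sets_into_space[OF C] by auto
      then show ?thesis using A C by (simp add: finite_measure_Diff)
    qed
    have "(\<lambda>n. prob (C n) - prob (A \<inter> C n)) \<longlonglongrightarrow> c - prob A * c"
      using compl total by (intro tendsto_diff)
    then show ?case unfolding eq prob_compl[OF A] by (simp add: left_diff_distrib)
  next
    case (union A)
    then have A: "A i \<in> events" for i using G(3) by auto
    have dis: "disjoint_family (\<lambda>i. A i \<inter> C n)" for n
      using union(1) by (auto simp: disjoint_family_on_def)
    have sums: "(\<lambda>i. prob (A i)) sums prob (\<Union>i. A i)"
      using union(1) A by (intro finite_measure_UNION) auto
    have sums': "(\<lambda>i. prob (A i \<inter> C n)) sums prob ((\<Union>i. A i) \<inter> C n)" for n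
    proof -
      have "(\<lambda>i. prob (A i \<inter> C n)) sums prob (\<Union>i. A i \<inter> C n)"
        using dis[of n] A C[of n] by (intro finite_measure_UNION) auto
      also have "(\<Union>i. A i \<inter> C n) = (\<Union>i. A i) \<inter> C n" by auto
      finally show ?thesis .
    qed
    have "(\<lambda>n. \<Sum>i. prob (A i \<inter> C n)) \<longlonglongrightarrow> (\<Sum>i. prob (A i) * c)"
    proof (rule tannerys_theorem[THEN conjunct2, THEN conjunct2])
      show "(\<lambda>n. prob (A i \<inter> C n)) \<longlonglongrightarrow> prob (A i) * c" for i using union by simp
      show "summable (\<lambda>i. prob (A i))" using sums by (simp add: sums_iff)
      have "norm (prob (A i \<inter> C n)) \<le> prob (A i)" for i n
        using A by (auto intro: finite_measure_mono)
      then show "\<forall>\<^sub>F (i, n) in at_top \<times>\<^sub>F sequentially. norm (prob (A i \<inter> C n)) \<le> prob (A i)"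
        by (auto intro: always_eventually)
    qed simp
    then show ?case using sums sums' by (simp add: sums_iff suminf_mult2[symmetric])
  qed simp_all
qed

text \<open>Throughout, \<open>\<nu>\<close> is the law of one coordinate of an i.i.d. path, so that the product measure
  \<open>path_measure\<close> below is the law of the path.\<close>

locale iid_law = prob_space \<nu> for \<nu> :: "real measure" +
  assumes sets_law: "sets \<nu> = sets borel"
begin

abbreviation path_measure :: "(int \<Rightarrow> real) measure" where
  "path_measure \<equiv> Pi\<^sub>M UNIV (\<lambda>_. \<nu>)"

sublocale P: product_prob_space "\<lambda>_::int. \<nu>" UNIV ..

lemma sets_path_measure [measurable_cong]: "sets path_measure = sets paths"
  by (rule sets_PiM_cong) (simp_all add: sets_law)

lemma space_law [simp]: "space \<nu> = UNIV"
  using sets_eq_imp_space_eq[OF sets_law] by simp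

lemma space_path_measure [simp]: "space path_measure = UNIV"
  by (simp add: space_PiM)

lemma measurable_shift_path [measurable]: "shift n \<in> measurable path_measure path_measure"
  using measurable_shift[of n] by (simp cong: measurable_cong_sets add: sets_path_measure)

lemma distr_shift: "distr path_measure path_measure (shift n) = path_measure"
  using distr_PiM_reindex[where K = UNIV and I = UNIV and M = "\<lambda>_. \<nu>" and f = "\<lambda>t. t + n"]
  by (simp add: shift_def[abs_def] prob_space_axioms restrict_UNIV)

lemma prob_shift:
  assumes "A \<in> sets path_measure"
  shows "P.prob (shift n -` A) = P.prob A"
  using assms measure_distr[of "shift n" path_measure path_measure A] by (simp add: distr_shift)

lemma sets_shift: "A \<in> sets path_measure \<Longrightarrow> shift n -` A \<in> sets path_measure"
  using measurable_sets[OF measurable_shift_path, of A n] by simp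

abbreviation cylinder :: "int set \<Rightarrow> (int \<Rightarrow> real set) \<Rightarrow> (int \<Rightarrow> real) set" where
  "cylinder J E \<equiv> {y. \<forall>j\<in>J. y j \<in> E j}"

lemma prob_cylinder:
  assumes "finite J" "\<And>j. j \<in> J \<Longrightarrow> E j \<in> sets \<nu>"
  shows "P.prob (cylinder J E) = (\<Prod>j\<in>J. prob (E j))"
proof -
  have "cylinder J E = prod_emb UNIV (\<lambda>_. \<nu>) J (Pi\<^sub>E J E)"
    by (auto simp: prod_emb_def PiE_iff)
  then show ?thesis
    using assms P.measure_PiM_emb[of J E] by simp
qed

lemma prod_algebra_cylinder:
  assumes "A \<in> prod_algebra UNIV (\<lambda>_::int. \<nu>)"
  shows "\<exists>J E. finite J \<and> (\<forall>j\<in>J. E j \<in> sets \<nu>) \<and> A = cylinder J E"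
proof -
  from prod_algebraE[OF assms] obtain J E where
    A: "A = prod_emb UNIV (\<lambda>_. \<nu>) J (Pi\<^sub>E J E)" "finite J" "\<And>i. i \<in> J \<Longrightarrow> E i \<in> sets \<nu>"
    by metis
  have "A = cylinder J E" unfolding A(1) by (auto simp: prod_emb_def PiE_iff)
  then show ?thesis using A(2,3) by blast
qed

text \<open>A shift by more than the distance of any two coordinates involved makes the two cylinders
  depend on disjoint sets of coordinates.\<close>

lemma cylinders_eventually_independent:
  assumes A: "A \<in> prod_algebra UNIV (\<lambda>_::int. \<nu>)" and B: "B \<in> prod_algebra UNIV (\<lambda>_::int. \<nu>)"
  shows "\<exists>N. \<forall>n. N \<le> \<bar>n\<bar> \<longrightarrow> P.prob (A \<inter> shift n -` B) = P.prob A * P.prob B"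
proof -
  obtain J E where A: "finite J" "\<And>j. j \<in> J \<Longrightarrow> E j \<in> sets \<nu>" "A = cylinder J E"
    using prod_algebra_cylinder[OF A] by blast
  obtain K F where B: "finite K" "\<And>j. j \<in> K \<Longrightarrow> F j \<in> sets \<nu>" "B = cylinder K F"
    using prod_algebra_cylinder[OF B] by blast
  obtain N where N: "\<And>j k. j \<in> J \<Longrightarrow> k \<in> K \<Longrightarrow> \<bar>j - k\<bar> < N"
  proof
    have "finite ((\<lambda>(j, k). \<bar>j - k\<bar>) ` (J \<times> K))" using A(1) B(1) by simp
    then show "\<bar>j - k\<bar> < Max (insert 0 ((\<lambda>(j, k). \<bar>j - k\<bar>) ` (J \<times> K))) + 1"
      if "j \<in> J" "k \<in> K" for j k
      using that by (intro zle_add1_eq_le[THEN iffD2] Max_ge) auto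
  qed
  show ?thesis
  proof (intro exI allI impI)
    fix n :: int assume n: "N \<le> \<bar>n\<bar>"
    define L where "L = (\<lambda>k. k + n) ` K"
    define G where "G j = (if j \<in> J then E j else F (j - n))" for j
    have disj: "J \<inter> L = {}"
    proof -
      have False if "k + n \<in> J" "k \<in> K" for k using N[OF that] n by simp
      then show ?thesis by (auto simp: L_def)
    qed
    have G_L: "G (k + n) = F k" if "k \<in> K" for k using disj that by (auto simp: G_def L_def)
    have L: "finite L" "\<And>j. j \<in> L \<Longrightarrow> G j \<in> sets \<nu>"
      using B G_L by (auto simp: L_def)
    have "A \<inter> shift n -` B = cylinder (J \<union> L) G"
    proof -
      have "cylinder (J \<union> L) G = {y. (\<forall>j\<in>J. y j \<in> G j) \<and> (\<forall>k\<in>K. y (k + n) \<in> G (k + n))}"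
        by (auto simp: L_def)
      also have "\<dots> = {y. (\<forall>j\<in>J. y j \<in> E j) \<and> (\<forall>k\<in>K. y (k + n) \<in> F k)}"
        by (simp add: G_L) (simp add: G_def)
      finally show ?thesis by (auto simp: A(3) B(3) shift_def)
    qed
    also have "P.prob \<dots> = (\<Prod>j\<in>J \<union> L. prob (G j))"
    proof (rule prob_cylinder)
      have "G j \<in> sets \<nu>" if "j \<in> J" for j using A(2)[OF that] that by (simp add: G_def)
      then show "G j \<in> sets \<nu>" if "j \<in> J \<union> L" for j using L(2) that by blast
    qed (use A(1) L(1) in simp)
    also have "\<dots> = (\<Prod>j\<in>J. prob (G j)) * (\<Prod>j\<in>L. prob (G j))"
      using A(1) L(1) disj by (rule prod.union_disjoint)
    also have "(\<Prod>j\<in>L. prob (G j)) = (\<Prod>k\<in>K. prob (F k))"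
      unfolding L_def by (subst prod.reindex) (auto simp: G_L)
    finally show "P.prob (A \<inter> shift n -` B) = P.prob A * P.prob B"
      using A B by (simp add: prob_cylinder G_def)
  qed
qed

text \<open>An invariant event \<open>A\<close> is independent of itself. Every shift of a cylinder \<open>B\<close> meets \<open>A\<close> in the
  same probability as \<open>B\<close> does, while far shifts of \<open>B\<close> become independent of all events, of \<open>A\<close>
  in particular; so \<open>A\<close> is independent of all cylinders. As the cylinders generate the
  sigma-algebra, \<open>A\<close> is then independent of all events. Both passages from cylinders to events are
  instances of the extension lemma above, the second one for a constant sequence.\<close>

theorem shift_ergodic:
  assumes A: "A \<in> sets path_measure" and inv: "shift 1 -` A = A"
  shows "P.prob A = 0 \<or> P.prob A = 1"
proof -
  let ?G = "prod_algebra UNIV (\<lambda>_::int. \<nu>)"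
  have G: "Int_stable ?G" "?G \<subseteq> sets path_measure" "sigma_sets (space path_measure) ?G = sets path_measure"
    by (auto simp: Int_stable_prod_algebra sets_PiM space_PiM)
  have inv_n: "shift (int n) -` A = A" for n
  proof (induction n)
    case (Suc n)
    have "shift (int (Suc n)) -` A = shift 1 -` (shift (int n) -` A)"
      by (auto simp: shift_shift add.commute)
    then show ?case using Suc inv by simp
  qed simp
  have cylinder_indep: "P.prob (B \<inter> A) = P.prob B * P.prob A" if B: "B \<in> ?G" for B
  proof -
    have B': "B \<in> sets path_measure" using B G(2) by auto
    have "(\<lambda>n. P.prob (A \<inter> shift (int n) -` B)) \<longlonglongrightarrow> P.prob A * P.prob B"
    proof (rule P.asymptotic_independence_extend[OF G _ _ _ A])
      fix C assume "C \<in> ?G"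
      from cylinders_eventually_independent[OF this B] obtain N
        where N: "\<And>n. N \<le> \<bar>n\<bar> \<Longrightarrow> P.prob (C \<inter> shift n -` B) = P.prob C * P.prob B" by blast
      have "\<forall>\<^sub>F n in sequentially. P.prob (C \<inter> shift (int n) -` B) = P.prob C * P.prob B"
        using eventually_ge_at_top[of "nat N"] by eventually_elim (auto intro: N)
      then show "(\<lambda>n. P.prob (C \<inter> shift (int n) -` B)) \<longlonglongrightarrow> P.prob C * P.prob B"
        by (rule tendsto_eventually)
    qed (use B' in \<open>auto simp: sets_shift prob_shift\<close>)
    moreover have "P.prob (A \<inter> shift (int n) -` B) = P.prob (B \<inter> A)" for n
    proof -
      have "A \<inter> shift (int n) -` B = shift (int n) -` (B \<inter> A)" using inv_n[of n] by auto
      then show ?thesis using prob_shift[of "B \<inter> A"] A B' by simp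
    qed
    ultimately show ?thesis by (simp add: LIMSEQ_const_iff mult.commute)
  qed
  have "(\<lambda>n::nat. P.prob (A \<inter> A)) \<longlonglongrightarrow> P.prob A * P.prob A"
    by (rule P.asymptotic_independence_extend[OF G]) (use A cylinder_indep in simp_all)
  then have "P.prob A = P.prob A * P.prob A" by (simp add: LIMSEQ_const_iff)
  then show ?thesis by auto
qed

end

lemma shift_invariant_iff: "shift_invariant A \<longleftrightarrow> shift 1 -` A = A"
  by (simp add: shift_invariant_def shift_def[abs_def])

lemma iid_process_path_law:
  assumes M: "prob_space M" and iid: "iid_process M Z"
  shows "iid_law (distr M borel (Z 0))"
    "(\<lambda>x t. Z t x) \<in> measurable M paths"
    "distr M paths (\<lambda>x t. Z t x) = Pi\<^sub>M UNIV (\<lambda>_. distr M borel (Z 0))"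
proof -
  interpret prob_space M by fact
  have indep: "indep_vars (\<lambda>_. borel) Z UNIV"
    and law: "distr M borel (Z t) = distr M borel (Z 0)" for t
    using iid unfolding iid_process_def by blast+
  have Z: "Z t \<in> borel_measurable M" for t
    using indep by (auto simp: indep_vars_def2)
  show "iid_law (distr M borel (Z 0))"
    using Z by (auto simp: iid_law_def iid_law_axioms_def intro: prob_space_distr)
  show "(\<lambda>x t. Z t x) \<in> measurable M paths" using Z by (intro measurable_pathI)
  have "distr M paths (\<lambda>x. \<lambda>t\<in>UNIV. Z t x) = Pi\<^sub>M UNIV (\<lambda>t. distr M borel (Z t))"
    by (rule indep_vars_iff_distr_eq_PiM'[THEN iffD1, OF _ _ indep]) (use Z in auto)
  also have "(\<lambda>t. distr M borel (Z t)) = (\<lambda>_. distr M borel (Z 0))"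
    by (rule ext) (rule law)
  finally show "distr M paths (\<lambda>x t. Z t x) = Pi\<^sub>M UNIV (\<lambda>_. distr M borel (Z 0))"
    by (simp add: restrict_UNIV)
qed

text \<open>Almost surely, the path of \<open>Y\<close> is the image of the path of \<open>Z\<close> under a map \<open>\<Phi>\<close> that commutes
  with the shift. Such a map carries the shift invariance of the law and the triviality of the
  invariant events over from \<open>Z\<close> to \<open>Y\<close>.\<close>

theorem factor_of_iid_stationary_ergodic:
  assumes M: "prob_space M" and iid: "iid_process M Z"
    and F [measurable]: "F \<in> borel_measurable paths"
    and Y [measurable]: "\<And>t. Y t \<in> borel_measurable M"
    and YF: "\<And>t. AE x in M. Y t x = F (\<lambda>k. Z (k + t) x)"
  shows "strictly_stationary M Y" and "ergodic M Y"
proof -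
  define \<nu> where "\<nu> = distr M borel (Z 0)"
  interpret iid_law \<nu> unfolding \<nu>_def by (rule iid_process_path_law[OF M iid])
  define \<zeta> where "\<zeta> x = (\<lambda>t. Z t x)" for x
  have \<zeta>[measurable]: "\<zeta> \<in> measurable M paths" and law: "distr M paths \<zeta> = path_measure"
    using iid_process_path_law[OF M iid] by (auto simp: \<nu>_def \<zeta>_def[abs_def])
  define \<Phi> where "\<Phi> z t = F (shift t z)" for z t
  have \<Phi>[measurable]: "\<Phi> \<in> measurable paths paths"
    by (rule measurable_pathI) (simp add: \<Phi>_def)
  have \<Phi>_t[measurable]: "(\<lambda>z. \<Phi> z t) \<in> borel_measurable paths" for t
    by (simp add: \<Phi>_def)
  have \<Phi>_shift: "\<Phi> (shift n z) t = \<Phi> z (t + n)" for n z t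
    by (simp add: \<Phi>_def shift_shift)
  have AE: "AE x in M. Y t x = \<Phi> (\<zeta> x) t" for t
    using YF[of t] by (simp add: \<Phi>_def \<zeta>_def shift_def)
  then have AE_all: "AE x in M. \<forall>t. Y t x = \<Phi> (\<zeta> x) t"
    by (simp add: AE_all_countable)
  have fin: "distr M (Pi\<^sub>M J (\<lambda>_. borel)) (\<lambda>x. \<lambda>t\<in>J. Y (t + h) x)
      = distr path_measure (Pi\<^sub>M J (\<lambda>_. borel)) (\<lambda>z. \<lambda>t\<in>J. \<Phi> z (t + h))" for J h
  proof -
    have "distr M (Pi\<^sub>M J (\<lambda>_. borel)) (\<lambda>x. \<lambda>t\<in>J. Y (t + h) x)
      = distr M (Pi\<^sub>M J (\<lambda>_. borel)) (\<lambda>x. \<lambda>t\<in>J. \<Phi> (\<zeta> x) (t + h))"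
    proof (rule distr_cong_AE)
      show "AE x in M. (\<lambda>t\<in>J. Y (t + h) x) = (\<lambda>t\<in>J. \<Phi> (\<zeta> x) (t + h))"
        using AE_all by eventually_elim simp
    qed simp_all
    also have "\<dots> = distr (distr M paths \<zeta>) (Pi\<^sub>M J (\<lambda>_. borel)) (\<lambda>z. \<lambda>t\<in>J. \<Phi> z (t + h))"
      by (subst distr_distr) (auto simp: comp_def)
    finally show ?thesis by (simp add: law)
  qed
  show "strictly_stationary M Y"
    unfolding strictly_stationary_def
  proof (intro conjI allI impI Y)
    fix J :: "int set" and h :: int
    have "distr path_measure (Pi\<^sub>M J (\<lambda>_. borel)) (\<lambda>z. \<lambda>t\<in>J. \<Phi> z (t + h))
      = distr path_measure (Pi\<^sub>M J (\<lambda>_. borel)) ((\<lambda>z. \<lambda>t\<in>J. \<Phi> z t) \<circ> shift h)"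
      by (rule arg_cong[where f = "distr _ _"]) (simp add: fun_eq_iff restrict_def \<Phi>_shift)
    also have "\<dots> = distr (distr path_measure path_measure (shift h))
        (Pi\<^sub>M J (\<lambda>_. borel)) (\<lambda>z. \<lambda>t\<in>J. \<Phi> z t)"
      by (subst distr_distr) auto
    also have "\<dots> = distr path_measure (Pi\<^sub>M J (\<lambda>_. borel)) (\<lambda>z. \<lambda>t\<in>J. \<Phi> z t)"
      by (simp add: distr_shift)
    finally show "distr M (Pi\<^sub>M J (\<lambda>_. borel)) (\<lambda>x. \<lambda>t\<in>J. Y (t + h) x)
      = distr M (Pi\<^sub>M J (\<lambda>_. borel)) (\<lambda>x. \<lambda>t\<in>J. Y t x)"
      using fin[of J h] fin[of J 0] by simp
  qed
  show "ergodic M Y"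
    unfolding ergodic_def
  proof (intro conjI allI ballI impI Y)
    fix A :: "(int \<Rightarrow> real) set" assume A: "A \<in> sets paths" and inv: "shift_invariant A"
    have "path_law M Y = distr M paths (\<lambda>x. \<Phi> (\<zeta> x))"
      unfolding path_law_def using AE_all
      by (intro distr_cong_AE measurable_pathI) (auto simp: fun_eq_iff)
    also have "\<dots> = distr (distr M paths \<zeta>) paths \<Phi>"
      by (subst distr_distr) (auto simp: comp_def)
    finally have "measure (path_law M Y) A = P.prob (\<Phi> -` A)"
      using A by (simp add: law measure_distr)
    moreover have "\<Phi> -` A \<in> sets path_measure"
      using measurable_sets[OF \<Phi> A] by (simp add: sets_path_measure space_PiM)
    moreover have "\<Phi> (shift 1 z) = shift 1 (\<Phi> z)" for z
      by (simp add: \<Phi>_shift fun_eq_iff) (simp add: shift_def)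
    then have "shift 1 -` (\<Phi> -` A) = \<Phi> -` A"
      using inv by (auto simp: shift_invariant_iff)
    ultimately show "measure (path_law M Y) A = 0 \<or> measure (path_law M Y) A = 1"
      using shift_ergodic by simp
  qed
qed

section \<open>Strict and weak stationarity\<close>

lemma strictly_stationary_integral:
  assumes st: "strictly_stationary M Y" and J: "finite J"
    and f: "f \<in> borel_measurable (Pi\<^sub>M J (\<lambda>_. borel))"
  shows "(\<integral>x. f (\<lambda>t\<in>J. Y (t + h) x) \<partial>M) = (\<integral>x. (f (\<lambda>t\<in>J. Y t x) :: real) \<partial>M)"
proof -
  have [measurable]: "Y t \<in> borel_measurable M" for t
    using st by (simp add: strictly_stationary_def)
  have "(\<integral>x. f (\<lambda>t\<in>J. Y (t + h) x) \<partial>M)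
      = (\<integral>y. f y \<partial>distr M (Pi\<^sub>M J (\<lambda>_. borel)) (\<lambda>x. \<lambda>t\<in>J. Y (t + h) x))"
    by (rule integral_distr[OF measurable_restrict f, symmetric]) simp
  also have "\<dots> = (\<integral>y. f y \<partial>distr M (Pi\<^sub>M J (\<lambda>_. borel)) (\<lambda>x. \<lambda>t\<in>J. Y t x))"
    using st J by (simp add: strictly_stationary_def)
  also have "\<dots> = (\<integral>x. f (\<lambda>t\<in>J. Y t x) \<partial>M)"
    by (rule integral_distr[OF measurable_restrict f]) simp
  finally show ?thesis .
qed

lemma strictly_stationary_imp_weakly_stationary:
  assumes st: "strictly_stationary M Y" and sq: "\<And>t. integrable M (\<lambda>x. (Y t x)\<^sup>2)"
  shows "weakly_stationary M Y"
proof -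
  have mean: "integral\<^sup>L M (Y (t + h)) = integral\<^sup>L M (Y t)" for t h
    using strictly_stationary_integral[OF st, of "{t}" "\<lambda>v. v t" h] by simp
  have "covariance M (Y (t + h)) (Y (u + h)) = covariance M (Y t) (Y u)" for t u h
    using strictly_stationary_integral[OF st, of "{t, u}"
        "\<lambda>v. (v t - integral\<^sup>L M (Y t)) * (v u - integral\<^sup>L M (Y u))" h]
    by (simp add: covariance_def mean)
  then show ?thesis
    using st sq mean by (simp add: weakly_stationary_def strictly_stationary_def)
qed

section \<open>SFIEGARCH processes\<close>

lemma distr_eq_integrable_iff:
  assumes "distr M borel U = distr M borel V" "U \<in> borel_measurable M" "V \<in> borel_measurable M"
    "(f :: real \<Rightarrow> real) \<in> borel_measurable borel"
  shows "integrable M (\<lambda>x. f (U x)) \<longleftrightarrow> integrable M (\<lambda>x. f (V x))"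
  using assms integrable_distr_eq[of U M borel f] integrable_distr_eq[of V M borel f] by simp

lemma measurable_abs_ln [measurable]: "abs_ln \<in> borel_measurable borel"
  unfolding abs_ln_def[abs_def] by measurable

text \<open>The terms are independent and centred, and their variances are \<open>(lam k)\<^sup>2\<close> times one constant, the
  variance of \<open>g (Z 0)\<close>. Square summability of \<open>lam\<close> is therefore what the one-series
  theorem asks for.\<close>

lemma log_volatility_series:
  assumes M: "prob_space M" and sf: "sfiegarch M p d q s \<alpha> \<beta> lam \<omega> \<theta> \<gamma> Z \<sigma> X" and d: "d < 1 / 2"
  shows "AE x in M. summable (log_volatility_term M \<theta> \<gamma> lam Z t x)"
    and "integrable M (\<lambda>x. (\<Sum>k. log_volatility_term M \<theta> \<gamma> lam Z t x k)\<^sup>2)"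
proof -
  interpret prob_space M by fact
  define \<nu> where "\<nu> = distr M borel (Z 0)"
  have indepZ: "indep_vars (\<lambda>_. borel) Z UNIV" and law: "distr M borel (Z t) = \<nu>"
    and Z_int: "integrable M (Z t)" and Z_sq: "integrable M (\<lambda>x. (Z t x)\<^sup>2)"
    and Z_mean: "expectation (Z t) = 0"
    and lam: "sfiegarch_coeffs p d q s \<alpha> \<beta> lam" for t
    using sf unfolding sfiegarch_def iid_process_def \<nu>_def by blast+
  have Z [measurable]: "Z t \<in> borel_measurable M" for t
    using Z_int by auto
  define G where "G = innovation_g M \<theta> \<gamma> Z"
  define c where "c = (\<integral>z. \<bar>z\<bar> \<partial>\<nu>)"
  have abs_mean: "expectation (\<lambda>x. \<bar>Z t x\<bar>) = c" for t
    using integral_distr[of "Z t" M borel abs] by (simp add: c_def law)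
  define g where "g z = \<theta> * z + \<gamma> * (\<bar>z\<bar> - c)" for z
  have [measurable]: "g \<in> borel_measurable borel" unfolding g_def by measurable
  have G: "G t x = g (Z t x)" for t x by (simp add: G_def g_def innovation_g_def abs_mean)
  have G_mean: "expectation (G t) = 0" for t
    unfolding G_def innovation_g_def abs_mean using Z_int[of t] Z_mean[of t] abs_mean[of t]
    by (simp add: prob_space)
  have G_sq: "integrable M (\<lambda>x. (G t x)\<^sup>2)" for t
  proof -
    have "integrable M (\<lambda>x. (\<theta> * Z t x + \<gamma> * (\<bar>Z t x\<bar> - c))\<^sup>2)"
    proof (rule integrable_square_add)
      have "integrable M (\<lambda>x. \<gamma>\<^sup>2 * ((Z t x)\<^sup>2 + c\<^sup>2 - 2 * \<bar>Z t x\<bar> * c))"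
        using Z_int Z_sq by simp
      then show "integrable M (\<lambda>x. (\<gamma> * (\<bar>Z t x\<bar> - c))\<^sup>2)"
        by (simp add: power_mult_distrib power2_diff)
    qed (use Z_sq in \<open>simp_all add: power_mult_distrib\<close>)
    then show ?thesis by (simp add: G g_def)
  qed
  have G_var: "expectation (\<lambda>x. (G t x)\<^sup>2) = (\<integral>z. (g z)\<^sup>2 \<partial>\<nu>)" for t
    using integral_distr[of "Z t" M borel "\<lambda>z. (g z)\<^sup>2"] by (simp add: G law)
  define Y where "Y k x = log_volatility_term M \<theta> \<gamma> lam Z t x k" for k x
  have Y: "Y k x = lam k * G (t - 1 - int k) x" for k x
    by (simp add: Y_def log_volatility_term_def G_def)
  have "indep_vars (\<lambda>_. borel) (\<lambda>k. Z (t - 1 - int k)) UNIV"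
    by (rule indep_vars_reindex[OF indepZ]) (simp add: inj_def)
  then have "indep_vars (\<lambda>_. borel) (\<lambda>k x. lam k * g (Z (t - 1 - int k) x)) UNIV"
    by (rule indep_vars_compose2) simp
  then have indep: "indep_vars (\<lambda>_. borel) Y UNIV" by (simp add: Y[abs_def] G)
  have sq: "integrable M (\<lambda>x. (Y k x)\<^sup>2)" for k
    using G_sq by (simp add: Y power_mult_distrib)
  have mean: "expectation (Y k) = 0" for k
    using G_mean by (simp add: Y[abs_def])
  have "expectation (\<lambda>x. (Y k x)\<^sup>2) = (lam k)\<^sup>2 * (\<integral>z. (g z)\<^sup>2 \<partial>\<nu>)" for k
    by (simp add: Y power_mult_distrib G_var)
  then have summ: "summable (\<lambda>k. expectation (\<lambda>x. (Y k x)\<^sup>2))"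
    using sfiegarch_coeffs_square_summable[OF lam d] by (simp add: summable_mult2)
  show "AE x in M. summable (log_volatility_term M \<theta> \<gamma> lam Z t x)"
    using kolmogorov_one_series[OF indep sq mean summ] by (simp add: Y_def)
  show "integrable M (\<lambda>x. (\<Sum>k. log_volatility_term M \<theta> \<gamma> lam Z t x k)\<^sup>2)"
    using square_integrable_random_series[OF indep sq mean summ] by (simp add: Y_def)
qed

theorem theorem2p1:
  fixes M :: "'a measure"
    and p q s :: nat
    and d \<omega> \<theta> \<gamma> :: real
    and \<alpha> \<beta> lam :: "nat \<Rightarrow> real"
    and Z \<sigma> X :: "int \<Rightarrow> 'a \<Rightarrow> real"
  assumes "prob_space M"
    and "sfiegarch M p d q s \<alpha> \<beta> lam \<omega> \<theta> \<gamma> Z \<sigma> X"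
    and "\<not> (\<gamma> = 0 \<and> \<theta> = 0)"
    and "d < 1 / 2"
  shows "((\<forall>t. AE x in M. summable (log_volatility_term M \<theta> \<gamma> lam Z t x)) \<and>
          strictly_stationary M X \<and> ergodic M X) \<and>
         ((\<integral>\<^sup>+ x. abs_ln ((Z 0 x)\<^sup>2) \<partial>M) < \<infinity> \<longrightarrow>
            (\<forall>t. AE x in M. X t x \<noteq> 0) \<and>
            strictly_stationary M (\<lambda>t x. ln ((X t x)\<^sup>2)) \<and>
            ergodic M (\<lambda>t x. ln ((X t x)\<^sup>2)) \<and>
            ((\<integral>\<^sup>+ x. (abs_ln ((Z 0 x)\<^sup>2))\<^sup>2 \<partial>M) < \<infinity> \<longrightarrow>
               weakly_stationary M (\<lambda>t x. ln ((X t x)\<^sup>2))))"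
proof -
  interpret prob_space M by fact
  define \<nu> where "\<nu> = distr M borel (Z 0)"
  have iid: "iid_process M Z" and law: "distr M borel (Z t) = \<nu>"
    and Z_int: "integrable M (Z t)" and X [measurable]: "X t \<in> borel_measurable M"
    and model: "AE x in M. \<sigma> t x > 0 \<and> X t x = \<sigma> t x * Z t x \<and>
        ln ((\<sigma> t x)\<^sup>2) = \<omega> + (\<Sum>k. log_volatility_term M \<theta> \<gamma> lam Z t x k)" for t
    using assms(2) unfolding sfiegarch_def iid_process_def \<nu>_def by blast+
  have Z [measurable]: "Z t \<in> borel_measurable M" for t
    using Z_int by auto
  note series = log_volatility_series[OF assms(1,2,4)]
  define c where "c = (\<integral>z. \<bar>z\<bar> \<partial>\<nu>)"
  have abs_mean: "expectation (\<lambda>x. \<bar>Z t x\<bar>) = c" for t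
    using integral_distr[of "Z t" M borel abs] by (simp add: c_def law)
  \<comment> \<open>\<open>X t\<close> read off from the innovations seen from time \<open>t\<close>: the volatility comes from the
    coordinates before \<open>0\<close>, the innovation is the coordinate \<open>0\<close>.\<close>
  define F where "F z = exp ((\<omega> + (\<Sum>k. lam k * (\<theta> * z (- 1 - int k) + \<gamma> * (\<bar>z (- 1 - int k)\<bar> - c)))) / 2) * z 0"
    for z :: "int \<Rightarrow> real"
  have [measurable]: "F \<in> borel_measurable paths" unfolding F_def by measurable
  have X_F: "AE x in M. X t x = F (\<lambda>k. Z (k + t) x)" for t
    using model[of t]
  proof eventually_elim
    case (elim x)
    have "\<sigma> t x = exp (ln ((\<sigma> t x)\<^sup>2) / 2)" if "0 < \<sigma> t x" using that by (simp add: ln_realpow)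
    with elim have "X t x = exp ((\<omega> + (\<Sum>k. log_volatility_term M \<theta> \<gamma> lam Z t x k)) / 2) * Z t x"
      by metis
    then show ?case
      by (simp add: F_def log_volatility_term_def innovation_g_def abs_mean add.commute algebra_simps)
  qed
  have X_sse: "strictly_stationary M X" "ergodic M X"
    by (rule factor_of_iid_stationary_ergodic[OF assms(1) iid _ X X_F]; simp)+
  have lnX_F: "AE x in M. ln ((X t x)\<^sup>2) = ln ((F (\<lambda>k. Z (k + t) x))\<^sup>2)" for t
    using X_F[of t] by eventually_elim simp
  have lnX_sse: "strictly_stationary M (\<lambda>t x. ln ((X t x)\<^sup>2))" "ergodic M (\<lambda>t x. ln ((X t x)\<^sup>2))"
    by (rule factor_of_iid_stationary_ergodic[where F = "\<lambda>z. ln ((F z)\<^sup>2)", OF assms(1) iid _ _ lnX_F]; simp)+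
  have Z_nz: "AE x in M. Z t x \<noteq> 0" if "(\<integral>\<^sup>+ x. abs_ln ((Z 0 x)\<^sup>2) \<partial>M) < \<infinity>" for t
  proof -
    \<comment> \<open>\<open>abs_ln\<close> is infinite at \<open>0\<close>, so its integrability rules out an atom of \<open>Z 0\<close> there.\<close>
    have "AE x in M. abs_ln ((Z 0 x)\<^sup>2) \<noteq> \<infinity>"
      using that by (intro nn_integral_PInf_AE) auto
    then have "AE x in M. Z 0 x \<noteq> 0" by eventually_elim (auto simp: abs_ln_def)
    then have "AE z in distr M borel (Z 0). z \<noteq> 0" by (subst AE_distr_iff) auto
    then have "AE z in distr M borel (Z t). z \<noteq> 0" by (simp only: law)
    then show ?thesis by (subst (asm) AE_distr_iff) auto
  qed
  have X_nz: "AE x in M. X t x \<noteq> 0" if "(\<integral>\<^sup>+ x. abs_ln ((Z 0 x)\<^sup>2) \<partial>M) < \<infinity>" for t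
    using model[of t] Z_nz[OF that, of t] by eventually_elim auto
  have weak: "weakly_stationary M (\<lambda>t x. ln ((X t x)\<^sup>2))"
    if fin: "(\<integral>\<^sup>+ x. abs_ln ((Z 0 x)\<^sup>2) \<partial>M) < \<infinity>"
      and fin2: "(\<integral>\<^sup>+ x. (abs_ln ((Z 0 x)\<^sup>2))\<^sup>2 \<partial>M) < \<infinity>"
  proof (rule strictly_stationary_imp_weakly_stationary[OF lnX_sse(1)])
    fix t
    have "(\<integral>\<^sup>+ x. ennreal ((ln ((Z 0 x)\<^sup>2))\<^sup>2) \<partial>M) = (\<integral>\<^sup>+ x. (abs_ln ((Z 0 x)\<^sup>2))\<^sup>2 \<partial>M)"
    proof (rule nn_integral_cong_AE, use Z_nz[OF fin, of 0] in eventually_elim)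
      fix x assume "Z 0 x \<noteq> 0"
      then show "ennreal ((ln ((Z 0 x)\<^sup>2))\<^sup>2) = (abs_ln ((Z 0 x)\<^sup>2))\<^sup>2"
        by (simp add: abs_ln_def ennreal_power)
    qed
    then have "integrable M (\<lambda>x. (ln ((Z 0 x)\<^sup>2))\<^sup>2)"
      using fin2 by (intro integrableI_nonneg) auto
    then have lnZ: "integrable M (\<lambda>x. (ln ((Z t x)\<^sup>2))\<^sup>2)"
      using distr_eq_integrable_iff[where U = "Z t" and V = "Z 0" and M = M and f = "\<lambda>z. (ln (z\<^sup>2))\<^sup>2"] law by simp
    define S where "S x = (\<Sum>k. log_volatility_term M \<theta> \<gamma> lam Z t x k)" for x
    have [measurable]: "S \<in> borel_measurable M"
      unfolding S_def log_volatility_term_def innovation_g_def by measurable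
    have "integrable M (\<lambda>x. (S x)\<^sup>2)" using series(2)[of t] by (simp add: S_def)
    then have "integrable M (\<lambda>x. ((\<omega> + S x) + ln ((Z t x)\<^sup>2))\<^sup>2)"
      using lnZ by (intro integrable_square_add) auto
    moreover have "AE x in M. ((\<omega> + S x) + ln ((Z t x)\<^sup>2))\<^sup>2 = (ln ((X t x)\<^sup>2))\<^sup>2"
      using model[of t] Z_nz[OF fin, of t]
    proof eventually_elim
      case (elim x)
      then have "ln ((X t x)\<^sup>2) = ln ((\<sigma> t x)\<^sup>2) + ln ((Z t x)\<^sup>2)"
        by (simp add: power_mult_distrib ln_mult)
      with elim show ?case by (simp add: S_def)
    qed
    ultimately show "integrable M (\<lambda>x. (ln ((X t x)\<^sup>2))\<^sup>2)"
      by (subst (asm) integrable_cong_AE) auto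
  qed
  show ?thesis using series(1) X_sse lnX_sse X_nz weak by blast
qed

end
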